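(* Let $n$ be a positive integer and let $A=A_s+A_d\epsilon$ be an $n\times n$ dual number matrix, where $A_s=(a_{ijs})$ is a real primitive matrix and $A_d$ is a real matrix. Let $\rho>0$, and let $\mathbf{x}^{(0)}=\mathbf{x}^{(0)}_s+\mathbf{x}^{(0)}_d\epsilon$ be an initial $n$-dimensional dual number vector whose standard part $\mathbf{x}^{(0)}_s$ is the vector of ones. Let $\{\underline{\lambda}_k\}$ and $\{\overline{\lambda}_k\}$ be the two dual number sequences generated from $\mathbf{x}^{(0)}$ by the Collatz method with shift $\rho$ applied to $A$, with standard parts $\underline{\lambda}_{s,k}$ and $\overline{\lambda}_{s,k}$. Then $$\lim_{k\to\infty}\left(\overline{\lambda}_{s,k}-\underline{\lambda}_{s,k}\right)=0.$$ Furthermore, if $A_s$ is weakly positive, then for all $k\geq 0$ $$\overline{\lambda}_{s,k+1}-\underline{\lambda}_{s,k+1}\le\alpha\left(\overline{\lambda}_{s,k}-\underline{\lambda}_{s,k}\right),$$ where $\alpha=1-\frac{\beta}{\overline{\mu}}$, $\beta=\min\left\{\min\limits_{i,j=1,\dots,n,\ i\ne j}a_{ijs},\ \min\limits_{i=1,\dots,n}a_{iis}+\rho\right\}$, and $\overline{\mu}=\rho+\max\limits_{i=1,\dots,n}\sum_{j=1}^na_{ijs}$.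
   Context: A dual number is $a=a_s+a_d\epsilon$ with $a_s,a_d\in\mathbb{R}$ (standard part, dual part), where $\epsilon\neq0$, $\epsilon^2=0$; $a+b=(a_s+b_s)+(a_d+b_d)\epsilon$, $ab=a_sb_s+(a_sb_d+a_db_s)\epsilon$, and if $b_s\ne0$ then $\frac{a}{b}=\frac{a_s}{b_s}+\left(\frac{a_d}{b_s}-\frac{a_s}{b_s}\frac{b_d}{b_s}\right)\epsilon$. Dual numbers are totally ordered by: $a>b$ if $a_s>b_s$, or $a_s=b_s$ and $a_d>b_d$; minima and maxima of dual numbers use this order. For a dual number vector $\mathbf{y}=\mathbf{y}_s+\mathbf{y}_d\epsilon$ with $\mathbf{y}_s\ne\mathbf{0}$, $\|\mathbf{y}\|_2=\|\mathbf{y}_s\|_2+\frac{\mathbf{y}_s^\top\mathbf{y}_d}{\|\mathbf{y}_s\|_2}\epsilon$. A real square matrix $A_s$ is primitive if $A_s\ge O$ entrywise and some power $A_s^m$ ($m\ge1$) is entrywise positive. A nonnegative matrix $A_s$ is weakly positive if $(A_s)_{ij}>0$ for all $i\neq j$. Collatz method with shift $\rho$ (the paper's Algorithm 1, run without a stopping test): put $B=A+\rho I_n$ and $\mathbf{y}^{(0)}=B\mathbf{x}^{(0)}$; for $k=0,1,2,\dots$ put $\mathbf{x}^{(k+1)}=\mathbf{y}^{(k)}/\|\mathbf{y}^{(k)}\|_2$ and $\mathbf{y}^{(k+1)}=B\mathbf{x}^{(k+1)}$; and for all $k\ge0$ $$\underline{\lambda}_k=\min_i\frac{(B\mathbf{x}^{(k)})_i}{x^{(k)}_i},\qquad\overline{\lambda}_k=\max_i\frac{(B\mathbf{x}^{(k)})_i}{x^{(k)}_i}.$$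 *)

theory Defs
  imports "HOL-Analysis.Analysis"
begin

datatype dual = Dual (std_part: real) (dual_part: real)

instantiation dual :: comm_ring_1
begin

definition zero_dual :: dual where "0 = Dual 0 0"
definition one_dual :: dual where "1 = Dual 1 0"
definition plus_dual :: "dual \<Rightarrow> dual \<Rightarrow> dual"
  where "a + b = Dual (std_part a + std_part b) (dual_part a + dual_part b)"
definition uminus_dual :: "dual \<Rightarrow> dual"
  where "- a = Dual (- std_part a) (- dual_part a)"
definition minus_dual :: "dual \<Rightarrow> dual \<Rightarrow> dual"
  where "a - b = Dual (std_part a - std_part b) (dual_part a - dual_part b)"
definition times_dual :: "dual \<Rightarrow> dual \<Rightarrow> dual"
  where "a * b = Dual (std_part a * std_part b)
                      (std_part a * dual_part b + dual_part a * std_part b)"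

instance
  by standard
    (auto simp: zero_dual_def one_dual_def plus_dual_def uminus_dual_def minus_dual_def
      times_dual_def algebra_simps)

end

definition dual_eps :: dual where "dual_eps = Dual 0 1"

lemma dual_eps_nonzero: "dual_eps \<noteq> 0"
  by (simp add: dual_eps_def zero_dual_def)

lemma dual_eps_square: "dual_eps ^ 2 = 0"
  by (simp add: dual_eps_def zero_dual_def times_dual_def power2_eq_square)

lemma dual_eq_std_plus_eps: "a = Dual (std_part a) 0 + Dual (dual_part a) 0 * dual_eps"
  by (cases a) (simp add: dual_eps_def plus_dual_def times_dual_def)

text \<open>
  Division is meaningful only if the standard part of the divisor is nonzero; otherwise the
  formula yields the irrelevant value \<open>0\<close>.
\<close>

instantiation dual :: inverse
begin

definition divide_dual :: "dual \<Rightarrow> dual \<Rightarrow> dual"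
  where "a div b = Dual (std_part a / std_part b)
     (dual_part a / std_part b - std_part a / std_part b * (dual_part b / std_part b))"
definition inverse_dual :: "dual \<Rightarrow> dual" where "inverse a = 1 div (a :: dual)"

instance ..

end

lemma dual_divide_cancel:
  assumes "std_part b \<noteq> 0"
  shows "a / b * b = (a :: dual)"
  using assms by (cases a) (simp add: divide_dual_def times_dual_def field_simps)

instantiation dual :: linorder
begin

definition less_dual :: "dual \<Rightarrow> dual \<Rightarrow> bool"
  where "a < b \<longleftrightarrow>
    std_part a < std_part b \<or> std_part a = std_part b \<and> dual_part a < dual_part b"
definition less_eq_dual :: "dual \<Rightarrow> dual \<Rightarrow> bool"
  where "a \<le> b \<longleftrightarrow> a < b \<or> a = (b :: dual)"

instance
  by standard (auto simp: less_dual_def less_eq_dual_def intro: dual.expand)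

end

definition vec_std :: "dual ^ 'n \<Rightarrow> real ^ 'n"
  where "vec_std x = (\<chi> i. std_part (x $ i))"

definition vec_dual :: "dual ^ 'n \<Rightarrow> real ^ 'n"
  where "vec_dual x = (\<chi> i. dual_part (x $ i))"

definition mat_std :: "dual ^ 'n ^ 'm \<Rightarrow> real ^ 'n ^ 'm"
  where "mat_std A = (\<chi> i j. std_part (A $ i $ j))"

text \<open>The 2-norm, meaningful for vectors with nonzero standard part.\<close>

definition dual_norm2 :: "dual ^ 'n \<Rightarrow> dual"
  where "dual_norm2 y = Dual (norm (vec_std y)) ((vec_std y \<bullet> vec_dual y) / norm (vec_std y))"

definition nonneg_mat :: "real ^ 'n ^ 'n \<Rightarrow> bool"
  where "nonneg_mat M \<longleftrightarrow> (\<forall>i j. 0 \<le> M $ i $ j)"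

text \<open>
  The operations \<open>*\<close> and \<open>^\<close> on type \<open>real ^ 'n ^ 'n\<close> are componentwise,
  so powers of matrices are iterated products \<open>**\<close>.
\<close>

definition mat_pow :: "real ^ 'n ^ 'n \<Rightarrow> nat \<Rightarrow> real ^ 'n ^ 'n"
  where "mat_pow M m = ((\<lambda>N. M ** N) ^^ m) (mat 1)"

definition primitive_mat :: "real ^ 'n ^ 'n \<Rightarrow> bool"
  where "primitive_mat M \<longleftrightarrow>
    nonneg_mat M \<and> (\<exists>m\<ge>1. \<forall>i j. 0 < mat_pow M m $ i $ j)"

definition weakly_positive_mat :: "real ^ 'n ^ 'n \<Rightarrow> bool"
  where "weakly_positive_mat M \<longleftrightarrow>
    nonneg_mat M \<and> (\<forall>i j. i \<noteq> j \<longrightarrow> 0 < M $ i $ j)"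

text \<open>\<open>mat c\<close> is the scalar matrix with diagonal entries \<open>c\<close>.\<close>

definition shifted_mat :: "dual ^ 'n ^ 'n \<Rightarrow> real \<Rightarrow> dual ^ 'n ^ 'n"
  where "shifted_mat A \<rho> = A + mat (Dual \<rho> 0)"

primrec collatz_x :: "dual ^ 'n ^ 'n \<Rightarrow> real \<Rightarrow> dual ^ 'n \<Rightarrow> nat \<Rightarrow> dual ^ 'n" where
  "collatz_x A \<rho> x0 0 = x0"
| "collatz_x A \<rho> x0 (Suc k) =
    (let y = shifted_mat A \<rho> *v collatz_x A \<rho> x0 k in \<chi> i. y $ i / dual_norm2 y)"

definition collatz_ratio :: "dual ^ 'n ^ 'n \<Rightarrow> real \<Rightarrow> dual ^ 'n \<Rightarrow> nat \<Rightarrow> 'n \<Rightarrow> dual"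
  where "collatz_ratio A \<rho> x0 k i =
    (shifted_mat A \<rho> *v collatz_x A \<rho> x0 k) $ i / collatz_x A \<rho> x0 k $ i"

definition collatz_lower :: "dual ^ 'n ^ 'n \<Rightarrow> real \<Rightarrow> dual ^ 'n \<Rightarrow> nat \<Rightarrow> dual"
  where "collatz_lower A \<rho> x0 k = Min (range (collatz_ratio A \<rho> x0 k))"

definition collatz_upper :: "dual ^ 'n ^ 'n \<Rightarrow> real \<Rightarrow> dual ^ 'n \<Rightarrow> nat \<Rightarrow> dual"
  where "collatz_upper A \<rho> x0 k = Max (range (collatz_ratio A \<rho> x0 k))"

text \<open>
  The minimum of the off-diagonal entries and of the shifted diagonal entries.  It is taken over
  one joint set because there are no off-diagonal entries in dimension one, where the minimum over
  the empty family counts as \<open>+\<infinity>\<close>.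
\<close>

definition collatz_beta :: "real ^ 'n ^ 'n \<Rightarrow> real \<Rightarrow> real"
  where "collatz_beta M \<rho> =
    Min ({M $ i $ j | i j. i \<noteq> j} \<union> {M $ i $ i + \<rho> | i. True})"

definition collatz_mu :: "real ^ 'n ^ 'n \<Rightarrow> real \<Rightarrow> real"
  where "collatz_mu M \<rho> = \<rho> + Max (range (\<lambda>i. \<Sum>j\<in>UNIV. M $ i $ j))"

definition collatz_alpha :: "real ^ 'n ^ 'n \<Rightarrow> real \<Rightarrow> real"
  where "collatz_alpha M \<rho> = 1 - collatz_beta M \<rho> / collatz_mu M \<rho>"

end

theory Submission
  imports Defs
begin

text \<open>
  Only standard parts enter the claim.  They follow the real power iteration
  \<open>u \<mapsto> B u / \<parallel>B u\<parallel>\<close> for the nonnegative matrix \<open>B = A\<^sub>s + \<rho> I\<close>, and since the order of the dual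
  numbers is lexicographic, standard parts commute with minima and maxima.  So the question is how
  the spread of the ratios \<open>(B u)\<^sub>i / u\<^sub>i\<close> behaves along a real power iteration, where scaling
  \<open>u\<close> is irrelevant (\<open>ratio_spread_scale\<close>).

  If \<open>C\<close> commutes with \<open>B\<close>, then \<open>(B C u)\<^sub>i / (C u)\<^sub>i = (C B u)\<^sub>i / (C u)\<^sub>i\<close> is the average of the
  old ratios \<open>(B u)\<^sub>j / u\<^sub>j\<close> with weights \<open>C\<^sub>i\<^sub>j u\<^sub>j\<close>.  Let \<open>j\<close> be an index where \<open>u\<close> is
  largest.  If all entries of \<open>C\<close> are at least \<open>b\<close> and all its row sums at most \<open>M\<close>, then every row
  \<open>i\<close> gives this one index at least the share \<open>b / M\<close> of its total weight, because
  \<open>(C u)\<^sub>i \<le> M u\<^sub>j\<close>.  All new ratios are thus pulled towards the same old ratio, and the spread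
  shrinks by the factor \<open>1 - b / M\<close> (\<open>ratio_spread_contraction\<close>).

  Everything follows from this by a choice of \<open>C\<close>.  For \<open>C = B\<close> and \<open>b = 0\<close> the spread never
  increases.  For \<open>C = B\<close> and \<open>b = \<beta>\<close> this is the one-step rate \<open>1 - \<beta> / \<mu>\<close>.
  For \<open>C = B\<^sup>m\<close>, which is positive if \<open>A\<^sub>s\<^sup>m\<close> is, the spread is contracted every \<open>m\<close> steps by
  a fixed factor below one, and so it tends to zero.
\<close>

section \<open>The spread of the Collatz ratios of a real vector\<close>

definition ratio :: "real ^ 'n ^ 'n \<Rightarrow> real ^ 'n \<Rightarrow> 'n \<Rightarrow> real"
  where "ratio B u i = (B *v u) $ i / u $ i"

definition ratio_spread :: "real ^ 'n ^ 'n \<Rightarrow> real ^ 'n \<Rightarrow> real"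
  where "ratio_spread B u = Max (range (ratio B u)) - Min (range (ratio B u))"

lemma ratio_le_Max: "ratio B u i \<le> Max (range (ratio B u))"
  by (rule Max_ge) auto

lemma Min_le_ratio: "Min (range (ratio B u)) \<le> ratio B u i"
  by (rule Min_le) auto

lemma ratio_spread_nonneg: "0 \<le> ratio_spread B u"
  using ratio_le_Max[of B u undefined] Min_le_ratio[of B u undefined]
  by (simp add: ratio_spread_def)

lemma ratio_spread_leI:
  assumes "\<And>i j. ratio B u i - ratio B u j \<le> d"
  shows "ratio_spread B u \<le> d"
proof -
  have "Max (range (ratio B u)) \<in> range (ratio B u)"
    by (rule Max_in) auto
  then obtain i where "Max (range (ratio B u)) = ratio B u i"
    by (rule rangeE)
  moreover have "Min (range (ratio B u)) \<in> range (ratio B u)"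
    by (rule Min_in) auto
  then obtain j where "Min (range (ratio B u)) = ratio B u j"
    by (rule rangeE)
  ultimately show ?thesis
    using assms by (simp add: ratio_spread_def)
qed

lemma ratio_spread_scale:
  assumes "c \<noteq> 0"
  shows "ratio_spread B (c *\<^sub>R u) = ratio_spread B u"
proof -
  have "ratio B (c *\<^sub>R u) = ratio B u"
    using assms by (simp add: fun_eq_iff ratio_def matrix_vector_mult_scaleR)
  then show ?thesis
    by (simp add: ratio_spread_def)
qed

text \<open>
  The total deficit \<open>\<Sum>i\<in>I. w i * (h - r i)\<close> has nonnegative summands, so it is at least the
  deficit at \<open>j\<close> alone.
\<close>

lemma weighted_average_le:
  fixes w r :: "'a \<Rightarrow> real"
  assumes "finite I" "j \<in> I"
    and w: "\<And>i. i \<in> I \<Longrightarrow> 0 \<le> w i" and pos: "0 < sum w I"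
    and share: "\<delta> * sum w I \<le> w j"
    and h: "\<And>i. i \<in> I \<Longrightarrow> r i \<le> h"
  shows "(\<Sum>i\<in>I. w i * r i) / sum w I \<le> h - \<delta> * (h - r j)"
proof -
  have "\<delta> * sum w I * (h - r j) \<le> w j * (h - r j)"
    using share h[OF \<open>j \<in> I\<close>] by (intro mult_right_mono) auto
  also have "\<dots> \<le> (\<Sum>i\<in>I. w i * (h - r i))"
    using assms by (intro member_le_sum) auto
  also have "\<dots> = h * sum w I - (\<Sum>i\<in>I. w i * r i)"
    by (simp add: right_diff_distrib sum_subtractf sum_distrib_left mult.commute)
  finally have "(\<Sum>i\<in>I. w i * r i) \<le> (h - \<delta> * (h - r j)) * sum w I"
    by (simp add: algebra_simps)
  then show ?thesis
    using pos by (simp add: pos_divide_le_eq)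
qed

lemma weighted_average_ge:
  fixes w r :: "'a \<Rightarrow> real"
  assumes "finite I" "j \<in> I"
    and "\<And>i. i \<in> I \<Longrightarrow> 0 \<le> w i" and "0 < sum w I"
    and "\<delta> * sum w I \<le> w j"
    and "\<And>i. i \<in> I \<Longrightarrow> l \<le> r i"
  shows "l + \<delta> * (r j - l) \<le> (\<Sum>i\<in>I. w i * r i) / sum w I"
  using weighted_average_le[of I j w \<delta> "\<lambda>i. - r i" "- l"] assms
  by (simp add: sum_negf algebra_simps)

text \<open>
  The common index required for the contraction is the position \<open>j\<close> of the largest entry of
  \<open>u\<close>: it depends on \<open>u\<close> but not on the row.
\<close>

lemma ratio_spread_contraction:
  fixes B C :: "real ^ 'n ^ 'n"
  assumes comm: "B ** C = C ** B"
    and b: "0 \<le> b" "\<And>i j. b \<le> C $ i $ j"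
    and M: "0 < M" "\<And>i. (\<Sum>j\<in>UNIV. C $ i $ j) \<le> M"
    and u: "\<And>i. 0 < u $ i" and Cu: "\<And>i. 0 < (C *v u) $ i"
  shows "ratio_spread B (C *v u) \<le> (1 - b / M) * ratio_spread B u"
proof (rule ratio_spread_leI)
  have "Max (range (($) u)) \<in> range (($) u)"
    by (rule Max_in) auto
  then obtain j where j: "Max (range (($) u)) = u $ j"
    by (rule rangeE)
  have u_le: "u $ k \<le> u $ j" for k
    unfolding j[symmetric] by (rule Max_ge) auto
  have C_nonneg: "0 \<le> C $ i $ k" for i k
    using b order_trans by blast
  define w where "w i k = C $ i $ k * u $ k" for i k
  have w_nonneg: "0 \<le> w i k" for i k
    using C_nonneg u by (simp add: w_def less_imp_le)
  have w_sum: "sum (w i) UNIV = (C *v u) $ i" for i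
    by (simp add: w_def matrix_vector_mult_def)
  have share: "b / M * sum (w i) UNIV \<le> w i j" for i
  proof -
    have "sum (w i) UNIV \<le> (\<Sum>k\<in>UNIV. C $ i $ k * u $ j)"
      unfolding w_def using C_nonneg u_le by (intro sum_mono mult_left_mono) auto
    also have "\<dots> = (\<Sum>k\<in>UNIV. C $ i $ k) * u $ j"
      by (simp add: sum_distrib_right)
    also have "\<dots> \<le> M * u $ j"
      using M(2) u by (intro mult_right_mono) (auto simp: less_imp_le)
    finally have "b / M * sum (w i) UNIV \<le> b / M * (M * u $ j)"
      using b(1) M(1) by (intro mult_left_mono) auto
    also have "\<dots> = b * u $ j"
      using M(1) by simp
    also have "\<dots> \<le> w i j"
      unfolding w_def using b(2) u by (intro mult_right_mono) (auto simp: less_imp_le)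
    finally show ?thesis .
  qed
  have average: "ratio B (C *v u) i = (\<Sum>k\<in>UNIV. w i k * ratio B u k) / sum (w i) UNIV" for i
  proof -
    have "(B *v (C *v u)) $ i = (C *v (B *v u)) $ i"
      by (simp add: matrix_vector_mul_assoc comm)
    also have "\<dots> = (\<Sum>k\<in>UNIV. C $ i $ k * (B *v u) $ k)"
      by (simp add: matrix_vector_mult_def)
    also have "\<dots> = (\<Sum>k\<in>UNIV. w i k * ratio B u k)"
      using u by (intro sum.cong) (auto simp: w_def ratio_def less_le)
    finally show ?thesis
      by (simp add: ratio_def[of B "C *v u"] w_sum)
  qed
  let ?hi = "Max (range (ratio B u))" and ?lo = "Min (range (ratio B u))"
  have upper: "ratio B (C *v u) i \<le> ?hi - b / M * (?hi - ratio B u j)" for i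
    unfolding average using w_nonneg Cu share ratio_le_Max
    by (intro weighted_average_le) (auto simp: w_sum)
  have lower: "?lo + b / M * (ratio B u j - ?lo) \<le> ratio B (C *v u) i" for i
    unfolding average using w_nonneg Cu share Min_le_ratio
    by (intro weighted_average_ge) (auto simp: w_sum)
  show "ratio B (C *v u) i - ratio B (C *v u) i' \<le> (1 - b / M) * ratio_spread B u" for i i'
    using upper[of i] lower[of i'] by (simp add: ratio_spread_def algebra_simps)
qed

section \<open>Powers of nonnegative matrices\<close>

lemma mat_pow_0: "mat_pow B 0 = mat 1"
  by (simp add: mat_pow_def)

lemma mat_pow_Suc: "mat_pow B (Suc m) = B ** mat_pow B m"
  by (simp add: mat_pow_def)

lemma mat_pow_commute: "B ** mat_pow B m = mat_pow B m ** B"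
proof (induction m)
  case 0
  show ?case by (simp add: mat_pow_0)
next
  case (Suc m)
  then show ?case
    by (metis mat_pow_Suc matrix_mul_assoc)
qed

lemma mat_pow_mono:
  fixes A B :: "real ^ 'n ^ 'n"
  assumes "nonneg_mat A" and "\<And>i j. A $ i $ j \<le> B $ i $ j"
  shows "0 \<le> mat_pow A m $ i $ j \<and> mat_pow A m $ i $ j \<le> mat_pow B m $ i $ j"
proof (induction m arbitrary: i j)
  case 0
  show ?case by (simp add: mat_pow_0 mat_def)
next
  case (Suc m)
  have A: "0 \<le> A $ i $ k" for k
    using assms(1) by (simp add: nonneg_mat_def)
  have B: "0 \<le> B $ i $ k" for k
    using A assms(2) by (rule order_trans)
  have "0 \<le> (\<Sum>k\<in>UNIV. A $ i $ k * mat_pow A m $ k $ j)"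
    using Suc A by (intro sum_nonneg mult_nonneg_nonneg) auto
  moreover have "(\<Sum>k\<in>UNIV. A $ i $ k * mat_pow A m $ k $ j)
      \<le> (\<Sum>k\<in>UNIV. B $ i $ k * mat_pow B m $ k $ j)"
    using Suc A B assms(2) by (intro sum_mono mult_mono) auto
  ultimately show ?case
    by (simp add: mat_pow_Suc matrix_matrix_mult_def)
qed

section \<open>Real power iterations\<close>

text \<open>
  The normalising factors are arbitrary positive numbers here, since ratios do not see them.
\<close>

locale power_iteration =
  fixes B :: "real ^ 'n ^ 'n" and u :: "nat \<Rightarrow> real ^ 'n" and c :: "nat \<Rightarrow> real"
  assumes B_nonneg: "nonneg_mat B"
    and u_pos: "0 < u k $ i"
    and c_pos: "0 < c k"
    and step: "u (Suc k) = c k *\<^sub>R (B *v u k)"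
begin

lemma B_mult_pos: "0 < (B *v u k) $ i"
  using u_pos[of "Suc k" i] c_pos[of k] by (simp add: step zero_less_mult_iff)

lemma spread_step:
  assumes "0 \<le> b" "\<And>i j. b \<le> B $ i $ j"
    and "0 < M" "\<And>i. (\<Sum>j\<in>UNIV. B $ i $ j) \<le> M"
  shows "ratio_spread B (u (Suc k)) \<le> (1 - b / M) * ratio_spread B (u k)"
proof -
  have "ratio_spread B (u (Suc k)) = ratio_spread B (B *v u k)"
    using c_pos[of k] by (simp add: step ratio_spread_scale)
  also have "\<dots> \<le> (1 - b / M) * ratio_spread B (u k)"
    using assms u_pos B_mult_pos by (intro ratio_spread_contraction) auto
  finally show ?thesis .
qed

lemma iterate:
  "\<exists>d>0. u (k + m) = d *\<^sub>R (mat_pow B m *v u k)"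
proof (induction m)
  case 0
  show ?case by (intro exI[of _ 1]) (simp add: mat_pow_0)
next
  case (Suc m)
  then obtain d where d: "d > 0" "u (k + m) = d *\<^sub>R (mat_pow B m *v u k)"
    by blast
  have "u (k + Suc m) = (c (k + m) * d) *\<^sub>R (mat_pow B (Suc m) *v u k)"
    by (simp add: step d(2) mat_pow_Suc matrix_vector_mult_scaleR matrix_vector_mul_assoc)
  then show ?case
    using d(1) c_pos[of "k + m"] by (intro exI[of _ "c (k + m) * d"]) simp
qed

text \<open>
  Averaging never widens the range of the ratios: this is the contraction with guaranteed share
  \<open>b = 0\<close>, for which any positive upper bound \<open>M\<close> of the row sums will do.
\<close>

lemma spread_decreasing: "decseq (\<lambda>k. ratio_spread B (u k))"
proof (rule decseq_SucI)
  fix k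
  define M where "M = (\<Sum>i\<in>UNIV. \<Sum>j\<in>UNIV. B $ i $ j) + 1"
  have B: "0 \<le> B $ i $ j" for i j
    using B_nonneg by (simp add: nonneg_mat_def)
  have "(\<Sum>j\<in>UNIV. B $ i $ j) \<le> (\<Sum>i\<in>UNIV. \<Sum>j\<in>UNIV. B $ i $ j)" for i
    using B by (intro member_le_sum sum_nonneg) auto
  moreover have "0 \<le> (\<Sum>i\<in>UNIV. \<Sum>j\<in>UNIV. B $ i $ j)"
    using B by (intro sum_nonneg) auto
  ultimately show "ratio_spread B (u (Suc k)) \<le> ratio_spread B (u k)"
    using spread_step[of 0 M k] B by (simp add: M_def add_increasing2)
qed

text \<open>
  The spread decreases to a limit \<open>L \<ge> 0\<close>.  A contraction by a factor \<open>q < 1\<close> every \<open>m\<close> steps gives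
  \<open>L \<le> q L\<close>, which leaves only \<open>L = 0\<close>.
\<close>

lemma spread_tendsto_0:
  assumes "\<And>i j. 0 < mat_pow B m $ i $ j"
  shows "(\<lambda>k. ratio_spread B (u k)) \<longlonglongrightarrow> 0"
proof -
  define C where "C = mat_pow B m"
  define b where "b = Min (range (\<lambda>(i, j). C $ i $ j))"
  define M where "M = Max (range (\<lambda>i. \<Sum>j\<in>UNIV. C $ i $ j))"
  have C_pos: "0 < C $ i $ j" for i j
    using assms by (simp add: C_def)
  have "b \<in> range (\<lambda>(i, j). C $ i $ j)"
    unfolding b_def by (rule Min_in) auto
  then have b_pos: "0 < b"
    using C_pos by auto
  have b_le: "b \<le> C $ i $ j" for i j
    unfolding b_def by (rule Min_le) (auto intro: range_eqI[of _ _ "(i, j)"])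
  have M: "(\<Sum>j\<in>UNIV. C $ i $ j) \<le> M" for i
    unfolding M_def by (rule Max_ge) auto
  have "0 < (\<Sum>j\<in>UNIV. C $ i $ j)" for i
    using C_pos by (intro sum_pos) auto
  then have M_pos: "0 < M"
    using M less_le_trans by blast
  have Cu_pos: "0 < (C *v u k) $ i" for k i
    using C_pos u_pos by (auto simp: matrix_vector_mult_def intro!: sum_pos)
  have contract: "ratio_spread B (u (k + m)) \<le> (1 - b / M) * ratio_spread B (u k)" for k
  proof -
    obtain d where "d > 0" "u (k + m) = d *\<^sub>R (C *v u k)"
      using iterate unfolding C_def by blast
    then have "ratio_spread B (u (k + m)) = ratio_spread B (C *v u k)"
      by (simp add: ratio_spread_scale)
    also have "\<dots> \<le> (1 - b / M) * ratio_spread B (u k)"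
      using b_pos b_le M_pos M u_pos Cu_pos
      by (intro ratio_spread_contraction) (auto simp: C_def mat_pow_commute)
    finally show ?thesis .
  qed
  obtain L where L: "(\<lambda>k. ratio_spread B (u k)) \<longlonglongrightarrow> L" "\<And>k. L \<le> ratio_spread B (u k)"
    using decseq_convergent[OF spread_decreasing, of 0] ratio_spread_nonneg by blast
  have "0 \<le> L"
    using L(1) ratio_spread_nonneg by (intro LIMSEQ_le_const) auto
  moreover have "L \<le> (1 - b / M) * L"
    by (rule LIMSEQ_le[OF LIMSEQ_ignore_initial_segment[OF L(1), of m]
          tendsto_mult_left[OF L(1)]]) (use contract in blast)
  then have "b / M * L \<le> 0"
    by (simp add: algebra_simps)
  then have "L \<le> 0"
    using b_pos M_pos by (simp add: divide_le_0_iff mult_le_0_iff)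
  ultimately show ?thesis
    using L(1) by simp
qed

end

section \<open>Standard parts of the Collatz iteration\<close>

lemma std_part_plus: "std_part (a + b) = std_part a + std_part b"
  by (simp add: plus_dual_def)

lemma std_part_times: "std_part (a * b) = std_part a * std_part b"
  by (simp add: times_dual_def)

lemma std_part_divide: "std_part (a / b) = std_part a / std_part b"
  by (simp add: divide_dual_def)

lemma std_part_sum: "std_part (sum f I) = (\<Sum>i\<in>I. std_part (f i))"
  by (induction I rule: infinite_finite_induct) (auto simp: std_part_plus zero_dual_def)

lemma vec_std_nth: "vec_std x $ i = std_part (x $ i)"
  by (simp add: vec_std_def)

lemma vec_std_matrix_vector_mult: "vec_std (A *v x) = mat_std A *v vec_std x"
  by (simp add: vec_eq_iff vec_std_nth mat_std_def matrix_vector_mult_def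
      std_part_sum std_part_times)

lemma mat_std_shifted: "mat_std (shifted_mat A \<rho>) = mat_std A + mat \<rho>"
  by (simp add: vec_eq_iff mat_std_def shifted_mat_def std_part_plus mat_def zero_dual_def)

lemma vec_std_collatz_Suc:
  "vec_std (collatz_x A \<rho> x0 (Suc k)) =
    inverse (norm ((mat_std A + mat \<rho>) *v vec_std (collatz_x A \<rho> x0 k))) *\<^sub>R
      ((mat_std A + mat \<rho>) *v vec_std (collatz_x A \<rho> x0 k))"
proof -
  define y where "y = shifted_mat A \<rho> *v collatz_x A \<rho> x0 k"
  have "vec_std (collatz_x A \<rho> x0 (Suc k)) = inverse (norm (vec_std y)) *\<^sub>R vec_std y"
    by (simp add: vec_eq_iff vec_std_nth std_part_divide dual_norm2_def Let_def
        divide_inverse mult.commute flip: y_def)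
  then show ?thesis
    by (simp add: y_def vec_std_matrix_vector_mult mat_std_shifted)
qed

lemma std_part_collatz_ratio:
  "std_part (collatz_ratio A \<rho> x0 k i) =
    ratio (mat_std A + mat \<rho>) (vec_std (collatz_x A \<rho> x0 k)) i"
  by (simp add: collatz_ratio_def std_part_divide ratio_def
      vec_std_matrix_vector_mult mat_std_shifted flip: vec_std_nth)

lemma mono_std_part: "mono std_part"
  by (rule monoI) (auto simp: less_eq_dual_def less_dual_def)

lemma std_part_collatz_spread:
  "std_part (collatz_upper A \<rho> x0 k) - std_part (collatz_lower A \<rho> x0 k) =
    ratio_spread (mat_std A + mat \<rho>) (vec_std (collatz_x A \<rho> x0 k))"
proof -
  have "std_part ` range (collatz_ratio A \<rho> x0 k) =
      range (ratio (mat_std A + mat \<rho>) (vec_std (collatz_x A \<rho> x0 k)))"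
    by (simp add: image_image std_part_collatz_ratio)
  then show ?thesis
    by (simp add: collatz_upper_def collatz_lower_def ratio_spread_def
        mono_Max_commute[OF mono_std_part] mono_Min_commute[OF mono_std_part])
qed

text \<open>
  The shift puts \<open>\<rho> > 0\<close> on the diagonal, so that a nonnegative matrix maps positive vectors to
  positive vectors.
\<close>

lemma shifted_mult_pos:
  fixes S :: "real ^ 'n ^ 'n"
  assumes "nonneg_mat S" "\<rho> > 0" "\<And>i. 0 < u $ i"
  shows "0 < ((S + mat \<rho>) *v u) $ i"
proof -
  have "0 < \<rho> * u $ i"
    using assms by simp
  also have "\<dots> \<le> (S + mat \<rho>) $ i $ i * u $ i"
    using assms by (intro mult_right_mono) (auto simp: nonneg_mat_def mat_def less_imp_le)
  also have "\<dots> \<le> (\<Sum>j\<in>UNIV. (S + mat \<rho>) $ i $ j * u $ j)"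
    using assms
    by (intro member_le_sum mult_nonneg_nonneg) (auto simp: nonneg_mat_def mat_def less_imp_le)
  finally show ?thesis
    by (simp add: matrix_vector_mult_def)
qed

lemma collatz_power_iteration:
  fixes A :: "dual ^ 'n ^ 'n"
  assumes "nonneg_mat (mat_std A)" "\<rho> > 0" "\<And>i. 0 < vec_std x0 $ i"
  shows "power_iteration (mat_std A + mat \<rho>) (\<lambda>k. vec_std (collatz_x A \<rho> x0 k))
    (\<lambda>k. inverse (norm ((mat_std A + mat \<rho>) *v vec_std (collatz_x A \<rho> x0 k))))"
proof -
  let ?B = "mat_std A + mat \<rho>" and ?u = "\<lambda>k. vec_std (collatz_x A \<rho> x0 k)"
  have norm_pos: "0 < norm (?B *v v)" if "\<And>i. 0 < v $ i" for v
    using shifted_mult_pos[OF assms(1,2) that, of undefined] by auto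
  have u_pos: "0 < ?u k $ i" for k i
  proof (induction k arbitrary: i)
    case 0
    show ?case using assms(3) by simp
  next
    case (Suc k)
    then show ?case
      using shifted_mult_pos[OF assms(1,2), of "?u k" i] norm_pos[of "?u k"]
      unfolding vec_std_collatz_Suc by simp
  qed
  show ?thesis
  proof
    show "nonneg_mat ?B"
      using assms(1,2) by (simp add: nonneg_mat_def mat_def)
    show "0 < ?u k $ i" for k i
      by (rule u_pos)
    show "0 < inverse (norm (?B *v ?u k))" for k
      using norm_pos u_pos by simp
  qed (rule vec_std_collatz_Suc)
qed

section \<open>The constants of the contraction factor\<close>

lemma collatz_beta_set:
  fixes S :: "real ^ 'n ^ 'n"
  shows "{S $ i $ j | i j. i \<noteq> j} \<union> {S $ i $ i + \<rho> | i. True} =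
    range (\<lambda>(i, j). (S + mat \<rho>) $ i $ j)"
  by (force simp: mat_def image_def)

lemma collatz_beta_le: "collatz_beta S \<rho> \<le> (S + mat \<rho>) $ i $ j"
  unfolding collatz_beta_def collatz_beta_set
  by (rule Min_le) (auto intro: range_eqI[of _ _ "(i, j)"])

lemma collatz_beta_nonneg:
  assumes "nonneg_mat S" "\<rho> \<ge> 0"
  shows "0 \<le> collatz_beta S \<rho>"
  unfolding collatz_beta_def collatz_beta_set
  using assms by (intro Min.boundedI) (auto simp: nonneg_mat_def mat_def)

lemma shifted_row_sum_le_collatz_mu:
  fixes S :: "real ^ 'n ^ 'n"
  shows "(\<Sum>j\<in>UNIV. (S + mat \<rho>) $ i $ j) \<le> collatz_mu S \<rho>"
proof -
  have "(\<Sum>j\<in>UNIV. S $ i $ j) \<le> Max (range (\<lambda>i. \<Sum>j\<in>UNIV. S $ i $ j))"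
    by (rule Max_ge) auto
  then show ?thesis
    by (simp add: collatz_mu_def mat_def sum.distrib)
qed

lemma collatz_mu_pos:
  assumes "nonneg_mat S" "\<rho> > 0"
  shows "0 < collatz_mu S \<rho>"
proof -
  have "0 \<le> (\<Sum>j\<in>UNIV. S $ undefined $ j)"
    using assms(1) by (intro sum_nonneg) (simp add: nonneg_mat_def)
  then show ?thesis
    using shifted_row_sum_le_collatz_mu[of S \<rho> undefined] assms(2)
    by (simp add: mat_def sum.distrib)
qed

section \<open>Convergence of the Collatz method\<close>

theorem theorem6p3:
  fixes A :: "dual ^ 'n ^ 'n" and \<rho> :: real and x0 :: "dual ^ 'n"
  assumes "primitive_mat (mat_std A)"
    and "\<rho> > 0"
    and "vec_std x0 = (\<chi> i. 1)"
  shows "(\<lambda>k. std_part (collatz_upper A \<rho> x0 k) - std_part (collatz_lower A \<rho> x0 k))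
           \<longlonglongrightarrow> 0
    \<and> (weakly_positive_mat (mat_std A) \<longrightarrow>
        (\<forall>k. std_part (collatz_upper A \<rho> x0 (Suc k)) - std_part (collatz_lower A \<rho> x0 (Suc k))
          \<le> collatz_alpha (mat_std A) \<rho>
            * (std_part (collatz_upper A \<rho> x0 k) - std_part (collatz_lower A \<rho> x0 k))))"
proof -
  let ?S = "mat_std A"
  have S: "nonneg_mat ?S"
    using assms(1) by (simp add: primitive_mat_def)
  interpret power_iteration "?S + mat \<rho>" "\<lambda>k. vec_std (collatz_x A \<rho> x0 k)"
    "\<lambda>k. inverse (norm ((?S + mat \<rho>) *v vec_std (collatz_x A \<rho> x0 k)))"
    using S assms(2,3) by (intro collatz_power_iteration) auto
  obtain m where "\<And>i j. 0 < mat_pow ?S m $ i $ j"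
    using assms(1) by (auto simp: primitive_mat_def)
  moreover have "mat_pow ?S m $ i $ j \<le> mat_pow (?S + mat \<rho>) m $ i $ j" for i j
    using assms(2) by (intro mat_pow_mono[OF S, THEN conjunct2]) (simp add: mat_def)
  ultimately have "0 < mat_pow (?S + mat \<rho>) m $ i $ j" for i j
    using less_le_trans by blast
  then have "(\<lambda>k. ratio_spread (?S + mat \<rho>) (vec_std (collatz_x A \<rho> x0 k))) \<longlonglongrightarrow> 0"
    by (rule spread_tendsto_0)
  moreover have "ratio_spread (?S + mat \<rho>) (vec_std (collatz_x A \<rho> x0 (Suc k)))
      \<le> collatz_alpha ?S \<rho> * ratio_spread (?S + mat \<rho>) (vec_std (collatz_x A \<rho> x0 k))" for k
    unfolding collatz_alpha_def
    using S assms(2)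
    by (intro spread_step collatz_beta_nonneg collatz_beta_le collatz_mu_pos
        shifted_row_sum_le_collatz_mu) auto
  ultimately show ?thesis
    unfolding std_part_collatz_spread by blast
qed

end
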